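(* Let $(Y,\|\cdot\|)$ be a normed space and $K\subset Y$ a closed, convex and pointed cone. Let $G,H\subseteq Y^*$ be nonempty, convex and $w^*$-compact, and let $\Psi:Y\to\mathbb{R}$, $\Psi(y):=\sigma_G(y)-\sigma_H(y)$. Then: (i) The implication $$H\subseteq\bigcap_{y\notin -K}\left(G-\operatorname{int}(P(y))\right)\ \Longrightarrow\ \{y\in Y:\Psi(y)\le 0\}\subseteq -K$$ holds. The converse implication is true if $Y$ is reflexive. (ii) If in addition $\Psi$ is $K$-monotone, $K$ is solid (i.e. $\operatorname{int}(K)\neq\emptyset$) and $G\cap H=\emptyset$, then $$H\subseteq\bigcap_{y\notin -K}\left(G-\operatorname{int}(P(y))\right)\ \Longrightarrow\ -\operatorname{int}(K)=\{y\in Y:\Psi(y)<0\}.$$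
   Context: Spaces are real; $Y^*$ is the topological dual. A cone is a set $C$ with $tx\in C$ for all $x\in C$, $t\ge 0$. For $A\subseteq Y^*$, $\sigma_A(y):=\sup_{y^*\in A}\langle y^*,y\rangle$. For $y\in Y$, $P(y):=\{y^*\in Y^*:\langle y^*,y\rangle\ge 0\}$, and $\operatorname{int}(P(y))$ is its norm interior in $Y^*$. $\Psi$ is $K$-monotone if $z-y\in K\Rightarrow\Psi(y)\le\Psi(z)$. *)

theory Defs
  imports "HOL-Analysis.Analysis"
begin

text \<open>The dual of a real normed space \<open>'a\<close> is \<open>'a \<Rightarrow>\<^sub>L real\<close> with the operator norm, so
  \<^const>\<open>interior\<close> and \<^const>\<open>open\<close> on that type refer to the norm topology.\<close>

text \<open>For scalar-valued operators the strong operator topology is the topology of pointwise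
  convergence on \<open>'a\<close>, i.e. the weak-star topology.\<close>

definition weak_star_topology :: "('a::real_normed_vector \<Rightarrow>\<^sub>L real) topology"
  where "weak_star_topology = strong_operator_topology"

definition reflexive_space :: "'a::real_normed_vector itself \<Rightarrow> bool"
  where "reflexive_space (_ :: 'a itself) \<longleftrightarrow>
    (\<forall>\<phi> :: ('a \<Rightarrow>\<^sub>L real) \<Rightarrow>\<^sub>L real. \<exists>y :: 'a. \<forall>f. blinfun_apply \<phi> f = blinfun_apply f y)"

definition pointed :: "'a::real_vector set \<Rightarrow> bool"
  where "pointed K \<longleftrightarrow> K \<inter> uminus ` K = {0}"

text \<open>The supremum is taken in \<open>real\<close>, so \<open>support_fun A y\<close> is meaningful only if \<open>A\<close> is
  nonempty and \<open>\<lambda>f. blinfun_apply f y\<close> is bounded above on \<open>A\<close>; for nonempty weak-star compact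
  \<open>A\<close> see \<open>bdd_above_weak_star_compact\<close> below.\<close>

definition support_fun :: "('a::real_normed_vector \<Rightarrow>\<^sub>L real) set \<Rightarrow> 'a \<Rightarrow> real"
  where "support_fun A y = (SUP f\<in>A. blinfun_apply f y)"

definition nonneg_functionals :: "'a::real_normed_vector \<Rightarrow> ('a \<Rightarrow>\<^sub>L real) set"
  where "nonneg_functionals y = {f. blinfun_apply f y \<ge> 0}"

definition set_difference_alg :: "'a::ab_group_add set \<Rightarrow> 'a set \<Rightarrow> 'a set"
  where "set_difference_alg A B = {a - b | a b. a \<in> A \<and> b \<in> B}"

definition monotone_wrt_cone :: "'a::real_vector set \<Rightarrow> ('a \<Rightarrow> real) \<Rightarrow> bool"
  where "monotone_wrt_cone K \<Psi> \<longleftrightarrow> (\<forall>y z. z - y \<in> K \<longrightarrow> \<Psi> y \<le> \<Psi> z)"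

lemma bdd_above_weak_star_compact:
  assumes "compactin weak_star_topology A"
  shows "bdd_above ((\<lambda>f. blinfun_apply f y) ` A)"
proof -
  have "compactin euclidean ((\<lambda>f. blinfun_apply f y) ` A)"
    using assms strong_operator_topology_continuous_evaluation image_compactin
    unfolding weak_star_topology_def by blast
  then show ?thesis
    by (intro bounded_imp_bdd_above compact_imp_bounded) simp
qed

end

theory Submission
  imports Defs
begin

text \<open>For \<open>y \<noteq> 0\<close> the Hahn--Banach theorem gives \<open>int(P(y)) = {f. f y > 0}\<close>, so the inclusion of
  \<open>H\<close> says exactly that \<open>\<sigma>\<^sub>H(y) < \<sigma>\<^sub>G(y)\<close> for every \<open>y \<notin> -K\<close>, the suprema being attained.
  For (ii), a point outside a weak-star compact convex set is strictly separated from it by some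
  vector, so disjointness of \<open>G\<close> and \<open>H\<close> yields \<open>y\<^sub>0\<close> with \<open>\<Psi>(y\<^sub>0) < 0\<close>. If \<open>k\<close> is interior
  to \<open>K\<close>, then \<open>k + t y\<^sub>0 \<in> K\<close> for small \<open>t > 0\<close>, hence \<open>\<Psi>(-k) \<le> t \<Psi>(y\<^sub>0) < 0\<close> by monotonicity.
  The space is not assumed complete, so \<open>\<Psi>\<close> need not be norm continuous; for the
  other inclusion continuity along the line \<open>y + t k\<close> is enough.\<close>

subsection \<open>Sublinear functionals and the Hahn--Banach theorem\<close>

text \<open>Homogeneity is demanded only as an inequality for nonnegative scalars, which is easy to
  verify for infima and suprema; equality follows by also scaling with
  \<open>inverse t\<close>.\<close>

definition sublinear_functional :: "('a::real_vector \<Rightarrow> real) \<Rightarrow> bool"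
  where "sublinear_functional p \<longleftrightarrow>
    (\<forall>x y. p (x + y) \<le> p x + p y) \<and> (\<forall>t\<ge>0. \<forall>x. p (t *\<^sub>R x) \<le> t * p x)"

lemma sublinear_functionalI:
  assumes "\<And>x y. p (x + y) \<le> p x + p y" "\<And>t x. t \<ge> 0 \<Longrightarrow> p (t *\<^sub>R x) \<le> t * p x"
  shows "sublinear_functional p"
  using assms unfolding sublinear_functional_def by blast

lemma sublinear_functional_add:
  "sublinear_functional p \<Longrightarrow> p (x + y) \<le> p x + p y"
  unfolding sublinear_functional_def by blast

lemma sublinear_functional_zero:
  assumes "sublinear_functional p" shows "p 0 = 0"
proof -
  have "p (0 *\<^sub>R 0) \<le> 0 * p 0" using assms unfolding sublinear_functional_def by blast
  moreover have "p (0 + 0) \<le> p 0 + p 0" using assms by (rule sublinear_functional_add)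
  ultimately show ?thesis by simp
qed

lemma sublinear_functional_scaleR:
  assumes p: "sublinear_functional p" and "t \<ge> 0"
  shows "p (t *\<^sub>R x) = t * p x"
proof (cases "t = 0")
  case True
  then show ?thesis using sublinear_functional_zero[OF p] by simp
next
  case False
  then have t: "t > 0" using assms by simp
  have le: "p (t *\<^sub>R x) \<le> t * p x" using p t unfolding sublinear_functional_def by auto
  have "p (inverse t *\<^sub>R (t *\<^sub>R x)) \<le> inverse t * p (t *\<^sub>R x)"
    using p t unfolding sublinear_functional_def by (meson inverse_nonnegative_iff_nonnegative less_imp_le)
  then have "t * p x \<le> p (t *\<^sub>R x)" using t by (simp add: field_simps)
  with le show ?thesis by simp
qed

text \<open>Supplies the lower bound that keeps a pointwise infimum of sublinear functionals below a
  fixed \<open>p\<close> finite.\<close>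

lemma sublinear_functional_minus:
  assumes "sublinear_functional p" shows "- p (- x) \<le> p x"
  using sublinear_functional_add[OF assms, of x "- x"] sublinear_functional_zero[OF assms] by simp

lemma sublinear_functional_norm: "sublinear_functional norm"
  by (rule sublinear_functionalI) (auto intro: norm_triangle_ineq)

text \<open>Every linear functional below the result satisfies \<open>f y \<ge> p y\<close>; this drives both the
  linearity of minimal sublinear functionals and the choice of a value at \<open>y\<close>.\<close>

lemma sublinear_functional_descend:
  assumes p: "sublinear_functional p"
  obtains q where "sublinear_functional q" "\<And>x. q x \<le> p x" "\<And>x. q x \<le> p (x + y) - p y"
proof
  \<comment> \<open>The parameter \<open>t = 0\<close> gives \<open>q \<le> p\<close>, and
    \<open>t = 1\<close> gives the bound with \<open>y\<close>.\<close>
  define q where "q x = (INF t\<in>{0..}. p (x + t *\<^sub>R y) - t * p y)" for x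
  have bdd: "bdd_below ((\<lambda>t. p (x + t *\<^sub>R y) - t * p y) ` {0..})" for x
  proof (rule bdd_belowI2[where m = "- p (- x)"])
    fix t :: real assume "t \<in> {0..}"
    then show "- p (- x) \<le> p (x + t *\<^sub>R y) - t * p y"
      using sublinear_functional_add[OF p, of "x + t *\<^sub>R y" "- x"] sublinear_functional_scaleR[OF p, of t y]
      by simp
  qed
  have le: "q x \<le> p (x + t *\<^sub>R y) - t * p y" if "t \<ge> 0" for x t
    unfolding q_def using that by (intro cINF_lower[OF bdd]) simp
  have greatest: "c \<le> q x" if "\<And>t. t \<ge> 0 \<Longrightarrow> c \<le> p (x + t *\<^sub>R y) - t * p y" for c x
    unfolding q_def using that by (intro cINF_greatest) auto
  show "q x \<le> p x" for x using le[of 0 x] by simp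
  show "q x \<le> p (x + y) - p y" for x using le[of 1 x] by simp
  show "sublinear_functional q"
  proof (rule sublinear_functionalI)
    fix u v
    \<comment> \<open>The parameters \<open>s\<close> and \<open>t\<close> vary independently and
      are merged into \<open>s + t\<close>; the infimum is then taken over \<open>s\<close> first
      and over \<open>t\<close> afterwards.\<close>
    have "q (u + v) - (p (v + t *\<^sub>R y) - t * p y) \<le> p (u + s *\<^sub>R y) - s * p y"
      if "s \<ge> 0" "t \<ge> 0" for s t
    proof -
      have "q (u + v) \<le> p ((u + s *\<^sub>R y) + (v + t *\<^sub>R y)) - (s + t) * p y"
        using le[of "s + t" "u + v"] that by (simp add: algebra_simps)
      with sublinear_functional_add[OF p, of "u + s *\<^sub>R y" "v + t *\<^sub>R y"]
      show ?thesis by (simp add: algebra_simps)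
    qed
    then have "q (u + v) - (p (v + t *\<^sub>R y) - t * p y) \<le> q u" if "t \<ge> 0" for t
      using that by (intro greatest) blast
    then have "q (u + v) - q u \<le> q v"
      by (intro greatest) (simp add: algebra_simps)
    then show "q (u + v) \<le> q u + q v" by simp
  next
    fix s :: real and x assume s: "s \<ge> 0"
    show "q (s *\<^sub>R x) \<le> s * q x"
    proof (cases "s = 0")
      case True
      then show ?thesis using le[of 0 0] sublinear_functional_zero[OF p] by simp
    next
      case False
      with s have s0: "s > 0" by simp
      \<comment> \<open>Replacing the parameter \<open>t\<close> by \<open>s * t\<close> lets the
        factor \<open>s\<close> be pulled out of \<open>p\<close>.\<close>
      have "q (s *\<^sub>R x) / s \<le> q x"
      proof (rule greatest)
        fix t :: real assume t: "t \<ge> 0"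
        have "q (s *\<^sub>R x) \<le> p (s *\<^sub>R (x + t *\<^sub>R y)) - (s * t) * p y"
          using le[of "s * t" "s *\<^sub>R x"] s t by (simp add: scaleR_add_right)
        also have "\<dots> = s * (p (x + t *\<^sub>R y) - t * p y)"
          unfolding sublinear_functional_scaleR[OF p s] by (simp add: algebra_simps)
        finally show "q (s *\<^sub>R x) / s \<le> p (x + t *\<^sub>R y) - t * p y"
          using s0 by (simp add: field_simps)
      qed
      then show ?thesis using s0 by (simp add: field_simps)
    qed
  qed
qed

text \<open>The pointwise infimum works: of any two members of a chain the smaller one lies below
  both, so subadditivity survives the infimum, and \<open>p\<close> keeps it finite.\<close>

lemma sublinear_functional_chain_bound:
  assumes sub: "\<And>q. q \<in> C \<Longrightarrow> sublinear_functional q" and dom: "\<And>q x. q \<in> C \<Longrightarrow> q x \<le> p x"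
    and ne: "C \<noteq> {}" and chain: "\<And>q r. q \<in> C \<Longrightarrow> r \<in> C \<Longrightarrow> q \<le> r \<or> r \<le> q"
  obtains u where "sublinear_functional u" "\<And>q x. q \<in> C \<Longrightarrow> u x \<le> q x"
proof
  define u where "u x = (INF q\<in>C. q x)" for x
  have bdd: "bdd_below ((\<lambda>q. q x) ` C)" for x
  proof (rule bdd_belowI2[where m = "- p (- x)"])
    fix q assume "q \<in> C"
    with dom[of q "- x"] sublinear_functional_minus[OF sub, of q x]
    show "- p (- x) \<le> q x" by simp
  qed
  show le: "u x \<le> q x" if "q \<in> C" for q x
    unfolding u_def using that by (intro cINF_lower[OF bdd])
  have greatest: "c \<le> u x" if "\<And>q. q \<in> C \<Longrightarrow> c \<le> q x" for c x
    unfolding u_def using that ne by (intro cINF_greatest) auto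
  show "sublinear_functional u"
  proof (rule sublinear_functionalI)
    fix x y
    have "u (x + y) - r y \<le> q x" if qr: "q \<in> C" "r \<in> C" for q r
    proof -
      obtain m where m: "m \<in> C" "m \<le> q" "m \<le> r" using chain[OF qr] qr by blast
      have "u (x + y) \<le> m x + m y"
        using le[OF m(1)] sublinear_functional_add[OF sub[OF m(1)]] by (rule order_trans)
      with le_funD[OF m(2), of x] le_funD[OF m(3), of y] show ?thesis by linarith
    qed
    then have "u (x + y) - r y \<le> u x" if "r \<in> C" for r
      using that by (intro greatest) blast
    then have "u (x + y) - u x \<le> u y"
      by (intro greatest) (simp add: algebra_simps)
    then show "u (x + y) \<le> u x + u y" by simp
  next
    fix t :: real and x assume t: "t \<ge> 0"
    have *: "u (t *\<^sub>R x) \<le> t * q x" if "q \<in> C" for q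
      using le[OF that, of "t *\<^sub>R x"] sublinear_functional_scaleR[OF sub[OF that] t] by simp
    show "u (t *\<^sub>R x) \<le> t * u x"
    proof (cases "t = 0")
      case True
      then show ?thesis using * ne by auto
    next
      case False
      with t have t0: "t > 0" by simp
      have "u (t *\<^sub>R x) / t \<le> u x"
        using * t0 by (intro greatest) (simp add: field_simps)
      then show ?thesis using t0 by (simp add: field_simps)
    qed
  qed
qed

text \<open>Descending from \<open>f\<close> in direction \<open>y\<close> must return
  \<open>f\<close> itself, so \<open>f x \<le> f (x + y) - f y\<close>, the reverse of
  subadditivity. Additivity makes \<open>f\<close> odd, which handles negative scalars.\<close>

lemma minimal_sublinear_functional_linear:
  assumes f: "sublinear_functional f"
    and min: "\<And>q. sublinear_functional q \<Longrightarrow> (\<And>x. q x \<le> f x) \<Longrightarrow> q = f"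
  shows "linear f"
proof -
  have add: "f (x + y) = f x + f y" for x y
  proof -
    obtain q where q: "sublinear_functional q" "\<And>x. q x \<le> f x" "\<And>x. q x \<le> f (x + y) - f y"
      using sublinear_functional_descend[OF f] by blast
    have "q = f" using q(1,2) by (rule min)
    with q(3)[of x] sublinear_functional_add[OF f, of x y] show ?thesis by simp
  qed
  have minus: "f (- x) = - f x" for x
    using add[of x "- x"] sublinear_functional_zero[OF f] by simp
  have "f (t *\<^sub>R x) = t * f x" for t x
  proof (cases "t \<ge> 0")
    case True
    then show ?thesis by (rule sublinear_functional_scaleR[OF f])
  next
    case False
    then have "f ((- t) *\<^sub>R x) = (- t) * f x" by (intro sublinear_functional_scaleR[OF f]) simp
    then show ?thesis using minus[of "t *\<^sub>R x"] by simp
  qed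
  with add show ?thesis by (intro linearI) auto
qed

text \<open>Zorn's lemma provides a minimal sublinear functional below \<open>p\<close>, and
  minimality forces linearity.\<close>

theorem sublinear_functional_dominates_linear:
  assumes p: "sublinear_functional p"
  obtains f where "linear f" "\<And>x. f x \<le> p x"
proof -
  define A where "A = {q. sublinear_functional q \<and> q \<le> p}"
  \<comment> \<open>The order is reversed, so that the maximal element from
    \<open>predicate_Zorn\<close> is a minimal functional.\<close>
  define R where "R = (\<lambda>q r :: 'a \<Rightarrow> real. r \<le> q)"
  have "\<exists>m\<in>A. \<forall>a\<in>A. R m a \<longrightarrow> a = m"
  proof (rule predicate_Zorn)
    show "partial_order_on A (relation_of R A)"
      by (rule partial_order_on_relation_ofI) (auto simp: R_def)
  next
    fix C assume C: "C \<in> Chains (relation_of R A)"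
    have CA: "C \<subseteq> A" using C by (auto simp: Chains_def relation_of_def)
    show "\<exists>u\<in>A. \<forall>a\<in>C. R a u"
    proof (cases "C = {}")
      case True
      then show ?thesis using p by (auto simp: A_def)
    next
      case False
      have chain: "q \<le> r \<or> r \<le> q" if "q \<in> C" "r \<in> C" for q r
        using C that by (auto simp: Chains_def relation_of_def R_def)
      have sub: "sublinear_functional q" and dom: "q x \<le> p x" if "q \<in> C" for q x
        using CA that by (auto simp: A_def le_fun_def)
      obtain u where u: "sublinear_functional u" "\<And>q x. q \<in> C \<Longrightarrow> u x \<le> q x"
        by (rule sublinear_functional_chain_bound[of C p, OF _ _ False]) (use sub dom chain in blast)+
      obtain q where "q \<in> C" using False by blast
      with u(2) dom have "u \<le> p" unfolding le_fun_def by (meson order_trans)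
      with u show ?thesis by (auto simp: A_def R_def le_fun_def)
    qed
  qed
  then obtain f where f: "sublinear_functional f" "f \<le> p"
    and min: "\<And>q. q \<in> A \<Longrightarrow> q \<le> f \<Longrightarrow> q = f"
    by (auto simp: A_def R_def)
  have "linear f"
  proof (rule minimal_sublinear_functional_linear[OF f(1)])
    fix q assume "sublinear_functional q" "\<And>x. q x \<le> f x"
    with f(2) show "q = f" by (intro min) (auto simp: A_def le_fun_def intro: order_trans)
  qed
  with f(2) that show ?thesis by (auto simp: le_fun_def)
qed

section \<open>Norming functionals and the interior of the set of functionals nonnegative at a
  point\<close>

corollary norming_functional:
  fixes y :: "'a::real_normed_vector"
  obtains f :: "'a \<Rightarrow>\<^sub>L real" where "blinfun_apply f y \<ge> norm y"
proof -
  obtain q where q: "sublinear_functional q" "\<And>x. q x \<le> norm x" "\<And>x. q x \<le> norm (x + y) - norm y"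
    using sublinear_functional_descend[OF sublinear_functional_norm] by blast
  obtain f where f: "linear f" "\<And>x. f x \<le> q x"
    using sublinear_functional_dominates_linear[OF q(1)] by blast
  have le: "f x \<le> norm x" for x using f(2) q(2) by (rule order_trans)
  have "bounded_linear f"
  proof (rule bounded_linear_intro[where K = 1])
    show "f (x + y) = f x + f y" for x y by (rule linear_add[OF f(1)])
    show "f (r *\<^sub>R x) = r *\<^sub>R f x" for r x by (rule linear_scale[OF f(1)])
    show "norm (f x) \<le> norm x * 1" for x
      using le[of x] le[of "- x"] linear_neg[OF f(1), of x] by simp
  qed
  then have "blinfun_apply (Blinfun f) = f" by (rule bounded_linear_Blinfun_apply)
  \<comment> \<open>At \<open>x = - y\<close> the last bound on \<open>q\<close> reads
    \<open>q (- y) \<le> norm 0 - norm y\<close>.\<close>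
  moreover have "f y \<ge> norm y"
    using f(2)[of "- y"] q(3)[of "- y"] linear_neg[OF f(1), of y] by simp
  ultimately show thesis by (intro that[of "Blinfun f"]) simp
qed

text \<open>If \<open>g\<close> is positive at \<open>y\<close>, then an interior point
  \<open>f\<close> can be moved to \<open>f - t *\<^sub>R g\<close> for a small \<open>t > 0\<close>
  and stays nonnegative at \<open>y\<close>, so \<open>f\<close> is positive there.\<close>

lemma interior_nonneg_functionals:
  fixes y :: "'a::real_normed_vector"
  assumes "y \<noteq> 0"
  shows "interior (nonneg_functionals y) = {f. blinfun_apply f y > 0}"
proof (rule interior_unique)
  show "{f. blinfun_apply f y > 0} \<subseteq> nonneg_functionals y"
    by (auto simp: nonneg_functionals_def)
  show "open {f :: 'a \<Rightarrow>\<^sub>L real. blinfun_apply f y > 0}"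
    by (intro open_Collect_less continuous_intros)
  fix T assume T: "T \<subseteq> nonneg_functionals y" "open T"
  obtain g :: "'a \<Rightarrow>\<^sub>L real" where "blinfun_apply g y \<ge> norm y" by (rule norming_functional)
  with assms have g: "blinfun_apply g y > 0" by (meson less_le_trans zero_less_norm_iff)
  show "T \<subseteq> {f. blinfun_apply f y > 0}"
  proof
    fix f assume "f \<in> T"
    have "((\<lambda>t. f - t *\<^sub>R g) \<longlongrightarrow> f - 0 *\<^sub>R g) (at_right 0)" by (intro tendsto_intros)
    then have "\<forall>\<^sub>F t in at_right 0. f - t *\<^sub>R g \<in> T"
      using T(2) \<open>f \<in> T\<close> by (intro topological_tendstoD) auto
    then have "\<forall>\<^sub>F t in at_right 0. t > 0 \<and> f - t *\<^sub>R g \<in> T"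
      using eventually_at_right_less by (rule eventually_conj[rotated])
    then obtain t where "t > 0" "f - t *\<^sub>R g \<in> T"
      using eventually_happens[of _ "at_right (0::real)"] by auto
    then have "t * blinfun_apply g y \<le> blinfun_apply f y" "t * blinfun_apply g y > 0"
      using T(1) g by (auto simp: nonneg_functionals_def blinfun.diff_left blinfun.scaleR_left)
    then show "f \<in> {f. blinfun_apply f y > 0}" by simp
  qed
qed

subsection \<open>Weak-star compact convex sets\<close>

lemma continuous_map_weak_star_evaluation:
  "continuous_map weak_star_topology euclidean (\<lambda>f. blinfun_apply f y)"
  unfolding weak_star_topology_def by (rule strong_operator_topology_continuous_evaluation)

lemma closedin_weak_star_hyperplane:
  "closedin weak_star_topology {f. blinfun_apply f y = c}"
  using closedin_continuous_map_preimage[OF continuous_map_weak_star_evaluation, of "{c}" y]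
  by (simp add: weak_star_topology_def strong_operator_topology_topspace)

lemma support_fun_upper:
  assumes "compactin weak_star_topology A" "f \<in> A"
  shows "blinfun_apply f y \<le> support_fun A y"
  unfolding support_fun_def using assms(2) by (rule cSUP_upper[OF _ bdd_above_weak_star_compact[OF assms(1)]])

lemma support_fun_attained:
  assumes "compactin weak_star_topology A" "A \<noteq> {}"
  obtains f where "f \<in> A" "support_fun A y = blinfun_apply f y"
proof -
  have "compactin euclidean ((\<lambda>f. blinfun_apply f y) ` A)"
    using assms(1) continuous_map_weak_star_evaluation by (rule image_compactin)
  then obtain f where f: "f \<in> A" "\<And>g. g \<in> A \<Longrightarrow> blinfun_apply g y \<le> blinfun_apply f y"
    using compact_attains_sup[of "(\<lambda>f. blinfun_apply f y) ` A"] assms(2) by auto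
  then have "support_fun A y \<le> blinfun_apply f y"
    unfolding support_fun_def by (intro cSUP_least) auto
  with support_fun_upper[OF assms(1) f(1)] f(1) that show ?thesis by (meson order_antisym)
qed

lemma sublinear_support_fun:
  assumes A: "compactin weak_star_topology A" "A \<noteq> {}"
  shows "sublinear_functional (support_fun A)"
proof (rule sublinear_functionalI)
  fix x y
  obtain f where "f \<in> A" "support_fun A (x + y) = blinfun_apply f (x + y)"
    using support_fun_attained[OF A] by blast
  with support_fun_upper[OF A(1)] show "support_fun A (x + y) \<le> support_fun A x + support_fun A y"
    by (simp add: blinfun.add_right add_mono)
next
  fix t :: real and x assume "t \<ge> 0"
  obtain f where "f \<in> A" "support_fun A (t *\<^sub>R x) = blinfun_apply f (t *\<^sub>R x)"
    using support_fun_attained[OF A] by blast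
  with support_fun_upper[OF A(1)] \<open>t \<ge> 0\<close> show "support_fun A (t *\<^sub>R x) \<le> t * support_fun A x"
    by (simp add: blinfun.scaleR_right mult_left_mono)
qed

text \<open>The domination hypothesis is inherited by the slice \<open>{g \<in> A. g x = h x}\<close>, which makes the
  induction over finite sets of vectors go through with separation in the plane only.\<close>

lemma weak_star_slice:
  assumes A: "compactin weak_star_topology A" "convex A"
    and dom: "\<And>y. \<exists>g\<in>A. blinfun_apply h y \<le> blinfun_apply g y"
  shows "\<exists>g\<in>A. blinfun_apply g x = blinfun_apply h x \<and> blinfun_apply h y \<le> blinfun_apply g y"
proof (rule ccontr)
  assume contra: "\<not> ?thesis"
  define e where "e f = (blinfun_apply f x, blinfun_apply f y)" for f :: "'a \<Rightarrow>\<^sub>L real"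
  have "continuous_map weak_star_topology euclidean e"
    using continuous_map_pairedI[OF continuous_map_weak_star_evaluation continuous_map_weak_star_evaluation]
    by (simp add: e_def[abs_def])
  then have "compactin euclidean (e ` A)" using A(1) by (intro image_compactin)
  then have "closed (e ` A)" by (simp add: compact_imp_closed)
  moreover have "linear e"
    by (rule linearI) (auto simp: e_def blinfun.add_left blinfun.scaleR_left)
  then have "convex (e ` A)" using A(2) by (rule convex_linear_image)
  \<comment> \<open>An element of \<open>A\<close> agreeing with \<open>h\<close> at both
    \<open>x\<close> and \<open>y\<close> would already witness the claim.\<close>
  moreover have "e h \<notin> e ` A" using contra by (auto simp: e_def)
  ultimately obtain c b where c: "c \<bullet> e h < b" "\<And>z. z \<in> e ` A \<Longrightarrow> b < c \<bullet> z"
    using separating_hyperplane_closed_point[of "e ` A" "e h"] by blast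
  \<comment> \<open>The normal \<open>c\<close> of the separating line becomes a vector of the
    space; domination at \<open>- v\<close> then contradicts the separation.\<close>
  define v where "v = fst c *\<^sub>R x + snd c *\<^sub>R y"
  have v: "c \<bullet> e f = blinfun_apply f v" for f
    by (simp add: v_def e_def inner_prod_def blinfun.add_right blinfun.scaleR_right)
  obtain g where "g \<in> A" "blinfun_apply h (- v) \<le> blinfun_apply g (- v)" using dom by blast
  with c(1) c(2)[of "e g"] show False by (simp add: v blinfun.minus_right)
qed

text \<open>The induction keeps \<open>y\<close> arbitrary: the hypothesis for \<open>F\<close>,
  over all \<open>y\<close>, says that the slice of \<open>A\<close> by \<open>F\<close> again
  dominates \<open>h\<close>, so \<open>weak_star_slice\<close> applies to that slice.\<close>

lemma weak_star_finite_slices: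
  assumes A: "compactin weak_star_topology A" "convex A"
    and dom: "\<And>y. \<exists>g\<in>A. blinfun_apply h y \<le> blinfun_apply g y" and "finite F"
  shows "\<exists>g\<in>A. (\<forall>x\<in>F. blinfun_apply g x = blinfun_apply h x) \<and> blinfun_apply h y \<le> blinfun_apply g y"
  using \<open>finite F\<close>
proof (induction F arbitrary: y)
  case empty
  then show ?case using dom by simp
next
  case (insert x F)
  define B where "B = A \<inter> (\<Inter>z\<in>F. {f. blinfun_apply f z = blinfun_apply h z})"
  \<comment> \<open>\<open>closedin_INT\<close> asks for a nonempty index set, so
    \<open>F = {}\<close>, where \<open>B\<close> is \<open>A\<close>, is treated apart.\<close>
  have "B = (if F = {} then A else A \<inter> (\<Inter>z\<in>F. {f. blinfun_apply f z = blinfun_apply h z}))"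
    by (simp add: B_def)
  moreover have "compactin weak_star_topology (A \<inter> (\<Inter>z\<in>F. {f. blinfun_apply f z = blinfun_apply h z}))"
    if "F \<noteq> {}"
    using that by (intro compact_Int_closedin A(1) closedin_INT closedin_weak_star_hyperplane)
  ultimately have "compactin weak_star_topology B" using A(1) by simp
  moreover have "convex {f. blinfun_apply f z = blinfun_apply h z}" for z
    by (auto simp: convex_def blinfun.add_left blinfun.scaleR_left simp flip: distrib_right)
  then have "convex B" unfolding B_def by (intro convex_Int A(2) convex_INT)
  ultimately have "\<exists>g\<in>B. blinfun_apply g x = blinfun_apply h x \<and> blinfun_apply h y \<le> blinfun_apply g y"
    by (rule weak_star_slice) (use insert.IH in \<open>fastforce simp: B_def\<close>)
  then show ?case by (auto simp: B_def)
qed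

text \<open>Without a separating vector, the hyperplanes of functionals agreeing with
  \<open>h\<close> at one vector have the finite intersection property on \<open>A\<close>.
  Compactness yields an element of \<open>A\<close> agreeing with \<open>h\<close> everywhere, that
  is, \<open>h\<close> itself.\<close>

theorem weak_star_separation:
  assumes A: "compactin weak_star_topology A" "convex A" "A \<noteq> {}" and "h \<notin> A"
  obtains y where "support_fun A y < blinfun_apply h y"
proof (rule ccontr)
  assume "\<not> thesis"
  with that have le: "blinfun_apply h y \<le> support_fun A y" for y by (meson not_le)
  have dom: "\<exists>g\<in>A. blinfun_apply h y \<le> blinfun_apply g y" for y
    using support_fun_attained[OF A(1,3), of y] le[of y] by metis
  define \<U> where "\<U> = range (\<lambda>y. {f. blinfun_apply f y = blinfun_apply h y})"
  have "A \<inter> \<Inter>\<U> \<noteq> {}"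
  proof (rule compactin_fip[THEN iffD1, OF A(1), THEN conjunct2, rule_format])
    show "(\<forall>C\<in>\<U>. closedin weak_star_topology C) \<and> (\<forall>\<F>. finite \<F> \<and> \<F> \<subseteq> \<U> \<longrightarrow> A \<inter> \<Inter>\<F> \<noteq> {})"
    proof (intro conjI ballI allI impI)
      show "closedin weak_star_topology C" if "C \<in> \<U>" for C
        using that closedin_weak_star_hyperplane by (auto simp: \<U>_def)
      fix \<F> assume "finite \<F> \<and> \<F> \<subseteq> \<U>"
      then obtain F where F: "finite F" "\<F> = (\<lambda>y. {f. blinfun_apply f y = blinfun_apply h y}) ` F"
        unfolding \<U>_def by (meson finite_subset_image)
      obtain g where "g \<in> A" "\<forall>x\<in>F. blinfun_apply g x = blinfun_apply h x"
        using weak_star_finite_slices[OF A(1,2) dom F(1)] by blast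
      then have "g \<in> A \<inter> \<Inter>\<F>" by (auto simp: F(2))
      then show "A \<inter> \<Inter>\<F> \<noteq> {}" by blast
    qed
  qed
  then obtain g where "g \<in> A" "\<And>y. blinfun_apply g y = blinfun_apply h y"
    by (auto simp: \<U>_def)
  then show False using \<open>h \<notin> A\<close> blinfun_eqI by metis
qed

section \<open>From the inclusion of \<open>H\<close> to support functions, and the proof of the
  theorem\<close>

text \<open>Membership means that \<open>g - h\<close> is positive at \<open>y\<close> for some
  \<open>g \<in> G\<close>; since the supremum over \<open>G\<close> is attained, this compares
  \<open>h\<close> with the support function.\<close>

lemma set_difference_interior_iff:
  fixes y :: "'a::real_normed_vector"
  assumes G: "compactin weak_star_topology G" "G \<noteq> {}" and "y \<noteq> 0"
  shows "h \<in> set_difference_alg G (interior (nonneg_functionals y))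
    \<longleftrightarrow> blinfun_apply h y < support_fun G y"
proof
  assume "h \<in> set_difference_alg G (interior (nonneg_functionals y))"
  then obtain g p where gp: "g \<in> G" "h = g - p" "blinfun_apply p y > 0"
    unfolding interior_nonneg_functionals[OF \<open>y \<noteq> 0\<close>] set_difference_alg_def by blast
  with support_fun_upper[OF G(1) gp(1), of y] show "blinfun_apply h y < support_fun G y"
    by (simp add: blinfun.diff_left)
next
  assume lt: "blinfun_apply h y < support_fun G y"
  obtain g where g: "g \<in> G" "support_fun G y = blinfun_apply g y"
    using support_fun_attained[OF G] by blast
  with lt have "g - h \<in> interior (nonneg_functionals y)"
    by (simp add: interior_nonneg_functionals[OF \<open>y \<noteq> 0\<close>] blinfun.diff_left)
  with g(1) show "h \<in> set_difference_alg G (interior (nonneg_functionals y))"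
    unfolding set_difference_alg_def by (intro CollectI exI[of _ g] exI[of _ "g - h"]) simp
qed

theorem lemma5p5:
  fixes K :: "'a::real_normed_vector set"
    and G H :: "('a \<Rightarrow>\<^sub>L real) set"
    and \<Psi> :: "'a \<Rightarrow> real"
  assumes "closed K" and "convex K" and "cone K" and "pointed K"
    and "G \<noteq> {}" and "convex G" and "compactin weak_star_topology G"
    and "H \<noteq> {}" and "convex H" and "compactin weak_star_topology H"
    and "\<And>y. \<Psi> y = support_fun G y - support_fun H y"
  shows
    "(H \<subseteq> (\<Inter>y\<in>{y. y \<notin> uminus ` K}.
            set_difference_alg G (interior (nonneg_functionals y)))
        \<longrightarrow> {y. \<Psi> y \<le> 0} \<subseteq> uminus ` K)
     \<and> (reflexive_space TYPE('a) \<longrightarrow>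
          {y. \<Psi> y \<le> 0} \<subseteq> uminus ` K \<longrightarrow>
          H \<subseteq> (\<Inter>y\<in>{y. y \<notin> uminus ` K}.
            set_difference_alg G (interior (nonneg_functionals y))))
     \<and> (monotone_wrt_cone K \<Psi> \<and> interior K \<noteq> {} \<and> G \<inter> H = {} \<longrightarrow>
          H \<subseteq> (\<Inter>y\<in>{y. y \<notin> uminus ` K}.
            set_difference_alg G (interior (nonneg_functionals y))) \<longrightarrow>
          uminus ` interior K = {y. \<Psi> y < 0})"
proof -
  note G = \<open>compactin weak_star_topology G\<close> \<open>G \<noteq> {}\<close>
  note H = \<open>compactin weak_star_topology H\<close> \<open>H \<noteq> {}\<close>
  note \<Psi> = assms(11)
  define Incl where "Incl \<longleftrightarrow> H \<subseteq> (\<Inter>y\<in>{y. y \<notin> uminus ` K}.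
    set_difference_alg G (interior (nonneg_functionals y)))"
  \<comment> \<open>Pointedness puts 0 into \<open>-K\<close>, so every \<open>y\<close> outside
    \<open>-K\<close> is nonzero and the characterization of the interior applies.\<close>
  have "0 \<in> uminus ` K" using \<open>pointed K\<close> by (auto simp: pointed_def)
  then have "y \<noteq> 0" if "y \<notin> uminus ` K" for y using that by metis
  then have "Incl \<longleftrightarrow> (\<forall>y. y \<notin> uminus ` K \<longrightarrow> (\<forall>h\<in>H. blinfun_apply h y < support_fun G y))"
    unfolding Incl_def using set_difference_interior_iff[OF G] by (auto simp: subset_iff)
  \<comment> \<open>Attainment of the supremum over \<open>H\<close> preserves the strict
    inequality.\<close>
  also have "\<dots> \<longleftrightarrow> (\<forall>y. y \<notin> uminus ` K \<longrightarrow> support_fun H y < support_fun G y)"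
    using support_fun_attained[OF H] support_fun_upper[OF H(1)] by (metis le_less_trans)
  also have "\<dots> \<longleftrightarrow> {y. \<Psi> y \<le> 0} \<subseteq> uminus ` K"
    by (auto simp: \<Psi> not_less[symmetric])
  finally have Incl_iff: "Incl \<longleftrightarrow> {y. \<Psi> y \<le> 0} \<subseteq> uminus ` K" .

  have "uminus ` interior K = {y. \<Psi> y < 0}"
    if mono: "monotone_wrt_cone K \<Psi>" and "interior K \<noteq> {}" and disj: "G \<inter> H = {}" and Incl
  proof (intro equalityI subsetI)
    fix z assume "z \<in> uminus ` interior K"
    then obtain k where k: "k \<in> interior K" "z = - k" by blast
    obtain h where h: "h \<in> H" "h \<notin> G" using disj H(2) by blast
    obtain y where "support_fun G y < blinfun_apply h y"
      using weak_star_separation[OF G(1) \<open>convex G\<close> G(2) h(2)] by blast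
    with support_fun_upper[OF H(1) h(1), of y] have y: "\<Psi> y < 0" by (simp add: \<Psi>)
    have "((\<lambda>t. k + t *\<^sub>R y) \<longlongrightarrow> k + 0 *\<^sub>R y) (at_right 0)" by (intro tendsto_intros)
    then have "\<forall>\<^sub>F t in at_right 0. k + t *\<^sub>R y \<in> interior K"
      using k(1) by (intro topological_tendstoD) auto
    then have "\<forall>\<^sub>F t in at_right 0. t > 0 \<and> k + t *\<^sub>R y \<in> interior K"
      using eventually_at_right_less by (rule eventually_conj[rotated])
    then obtain t where t: "t > 0" "k + t *\<^sub>R y \<in> interior K"
      using eventually_happens[of _ "at_right (0::real)"] by auto
    \<comment> \<open>Since \<open>z = - k\<close>, the difference is
      \<open>k + t *\<^sub>R y\<close>, and monotonicity compares \<open>z\<close> with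
      \<open>t *\<^sub>R y\<close>.\<close>
    then have "t *\<^sub>R y - z \<in> K" using interior_subset k(2) by (auto simp: add.commute)
    with mono have "\<Psi> z \<le> \<Psi> (t *\<^sub>R y)" unfolding monotone_wrt_cone_def by blast
    also have "\<dots> = t * \<Psi> y"
      using t(1) sublinear_functional_scaleR[OF sublinear_support_fun[OF G]]
        sublinear_functional_scaleR[OF sublinear_support_fun[OF H]]
      by (simp add: \<Psi> right_diff_distrib)
    also have "\<dots> < 0" using t(1) y by (simp add: mult_pos_neg)
    finally show "z \<in> {y. \<Psi> y < 0}" by simp
  next
    fix y assume "y \<in> {y. \<Psi> y < 0}"
    then have y: "\<Psi> y < 0" by simp
    obtain k where k: "k \<in> interior K" using \<open>interior K \<noteq> {}\<close> by blast
    \<comment> \<open>By subadditivity, \<Psi> grows along \<open>y + t *\<^sub>R k\<close> at rate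
      at most \<open>c\<close>; the term at \<open>- k\<close> comes from writing \<open>y\<close>
      as \<open>(y + t *\<^sub>R k) + t *\<^sub>R (- k)\<close>.\<close>
    define c where "c = support_fun G k + support_fun H (- k)"
    have "((\<lambda>t. \<Psi> y + t * c) \<longlongrightarrow> \<Psi> y + 0 * c) (at_right 0)" by (intro tendsto_intros)
    then have "\<forall>\<^sub>F t in at_right 0. \<Psi> y + t * c < 0"
      using y by (intro order_tendstoD) auto
    then have "\<forall>\<^sub>F t in at_right 0. t > 0 \<and> \<Psi> y + t * c < 0"
      using eventually_at_right_less by (rule eventually_conj[rotated])
    then obtain t where t: "t > 0" "\<Psi> y + t * c < 0"
      using eventually_happens[of _ "at_right (0::real)"] by auto
    have "support_fun G (y + t *\<^sub>R k) \<le> support_fun G y + t * support_fun G k"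
      using sublinear_functional_add[OF sublinear_support_fun[OF G], of y "t *\<^sub>R k"]
        sublinear_functional_scaleR[OF sublinear_support_fun[OF G], of t k] t(1) by simp
    moreover have "support_fun H y \<le> support_fun H (y + t *\<^sub>R k) + t * support_fun H (- k)"
      using sublinear_functional_add[OF sublinear_support_fun[OF H], of "y + t *\<^sub>R k" "t *\<^sub>R (- k)"]
        sublinear_functional_scaleR[OF sublinear_support_fun[OF H], of t "- k"] t(1) by simp
    ultimately have "\<Psi> (y + t *\<^sub>R k) \<le> \<Psi> y + t * c" by (simp add: \<Psi> c_def distrib_left)
    with t(2) \<open>Incl\<close> have "y + t *\<^sub>R k \<in> uminus ` K" unfolding Incl_iff by auto
    then obtain k' where k': "k' \<in> K" "y + t *\<^sub>R k = - k'" by blast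
    \<comment> \<open>Adding a point of \<open>K\<close> to a positive multiple of an interior point
      gives an interior point: the affine image of \<open>interior K\<close> is open and lies in
      \<open>K\<close>.\<close>
    have "(\<lambda>x. k' + t *\<^sub>R x) ` interior K \<subseteq> interior K"
    proof (rule interior_maximal)
      show "open ((\<lambda>x. k' + t *\<^sub>R x) ` interior K)" using t(1) by (intro open_affinity) auto
      show "(\<lambda>x. k' + t *\<^sub>R x) ` interior K \<subseteq> K"
      proof (rule image_subsetI)
        fix x assume "x \<in> interior K"
        then have "t *\<^sub>R x \<in> K" using \<open>cone K\<close> t(1) interior_subset[of K]
          unfolding cone_def by (meson less_imp_le subsetD)
        with k'(1) show "k' + t *\<^sub>R x \<in> K" using \<open>convex K\<close> \<open>cone K\<close> convex_cone[of K] by blast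
      qed
    qed
    with k have "k' + t *\<^sub>R k \<in> interior K" by blast
    moreover have "y = - (k' + t *\<^sub>R k)" using k'(2) by (simp add: algebra_simps)
    ultimately show "y \<in> uminus ` interior K" by blast
  qed
  then show ?thesis using Incl_iff unfolding Incl_def by blast
qed


end
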